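(* Let $A$ be a finite set of agents with $|A|\ge2$, and let $M^\ast$ be an auxiliary-colour simplicial secrecy model over $A$. For every formula $\varphi\in\mathcal{L}_{KS}$, every facet $X\in\mathrm{Fac}(M^\ast)$, and every function $\sigma:A\to G$ with $\sum_{a\in A}\sigma(a)=\iota(X)$, we have $\mathsf{Sh}(M^\ast),X^\sigma\Vdash\varphi$ if and only if $M^\ast,X\Vdash\varphi$.
   Context: $\mathsf{Prop}$ is a countable set of propositional variables. The language $\mathcal{L}_{KS}$ is $\varphi::=p\mid\neg\varphi\mid(\varphi\wedge\varphi)\mid K_a\varphi\mid S_a\varphi$ ($p\in\mathsf{Prop}$, $a\in A$). For a colour set $C$, a $C$-chromatic simplicial complex is $(V,\mathcal{F},\chi)$ where $V$ is non-empty, $\mathcal{F}$ is a non-empty family of finite non-empty subsets of $V$ closed under non-empty subsets, and $\chi:V\to C$ is injective on every face; facets are inclusion-maximal faces. Fix a fresh colour $\ast\notin A$. An auxiliary-colour simplicial secrecy model over $A$ is $M^\ast=(V,\mathcal{F},\chi,\nu,\{N_a^S\}_{a\in A})$ with $(V,\mathcal{F},\chi)$ $(A\cup\{\ast\})$-chromatic, every facet $X$ having $\chi[X]=A\cup\{\ast\}$, every vertex in some facet, $\nu:\mathrm{Fac}(M^\ast)\to\mathcal{P}(\mathsf{Prop})$, and for $a\in A$, $N_a^S:V_a\to\mathcal{P}(\mathcal{P}(\mathrm{Fac}(M^\ast)))$ (with $V_a$ the vertices of colour $a$) satisfying (SN): for all $v\in V_a$, $U\in N_a^S(v)$, $X\in\mathrm{St}(v)=\{X\in\mathrm{Fac}:v\in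 X\}$ and $b\in A\setminus\{a\}$ there is a facet $Y$ with $X\sim_b Y$ and $Y\notin U$. Here $v_a(X)$ is the vertex of colour $a$ in facet $X$ and $X\sim_a Y$ iff $v_a(X)=v_a(Y)$. Formulas are evaluated at facets: $p$ iff $p\in\nu(X)$; Boolean clauses as usual; $K_a\varphi$ iff $\varphi$ holds at all $Y$ with $X\sim_a Y$; $S_a\varphi$ iff $K_a\varphi$ holds at $X$ and $[\![\varphi]\!]\in N_a^S(v_a(X))$, with $[\![\varphi]\!]$ the set of facets satisfying $\varphi$. (A simplicial secrecy model is the same notion with colour set $A$ only, every facet having colour set $A$.) Share model: let $G=\mathbb{Z}^{(\mathrm{Fac}(M^\ast))}$ be the free abelian group on the facets of $M^\ast$ and $\iota(X)=e_X$ the canonical injection. For a facet $X$ and $\sigma:A\to G$ with $\sum_{a}\sigma(a)=\iota(X)$ put $X^\sigma=\{(a,v_a(X),\sigma(a)):a\in A\}$. $\mathsf{Sh}(M^\ast)$ has as facets all such $X^\sigma$, faces their downward closure, vertices all $(a,v_a(X),\sigma(a))$ occurring in them, colouring $(a,v,g)\mapsto a$, valuation $\nu^{sh}(X^\sigma)=\nu(X)$, and, writing $U^\uparrow=\{Y^\tau\in\mathrm{Fac}(\mathsf{Sh}(M^\ast)):Y\in U\}$ for $U\subseteq\mathrm{Fac}(M^\ast)$, neighborhoods $N_a^{S,sh}((a,v,g))=\{U^\uparrow:U\in N_a^S(v)\}$. Truth in $\mathsf{Sh}(M^\ast)$ is defined by the same clauses. *)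

theory Defs
  imports "HOL-Library.Countable" "HOL-Library.FuncSet" "HOL-Algebra.Free_Abelian_Groups"
begin

datatype ('p, 'c) form =
    Var 'p
  | Neg "('p, 'c) form"
  | Conj "('p, 'c) form" "('p, 'c) form"
  | Know 'c "('p, 'c) form"
  | Secret 'c "('p, 'c) form"

inductive_set L_KS :: "'c set \<Rightarrow> ('p, 'c) form set" for A :: "'c set" where
  "Var p \<in> L_KS A"
| "\<phi> \<in> L_KS A \<Longrightarrow> Neg \<phi> \<in> L_KS A"
| "\<phi> \<in> L_KS A \<Longrightarrow> \<psi> \<in> L_KS A \<Longrightarrow> Conj \<phi> \<psi> \<in> L_KS A"
| "a \<in> A \<Longrightarrow> \<phi> \<in> L_KS A \<Longrightarrow> Know a \<phi> \<in> L_KS A"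
| "a \<in> A \<Longrightarrow> \<phi> \<in> L_KS A \<Longrightarrow> Secret a \<phi> \<in> L_KS A"

(* Only the values of col on verts, of val on facets, and of nbhd a (for an agent a)
   on the vertices of colour a are meaningful. *)
record ('v, 'c, 'p) secrecy_structure =
  verts :: "'v set"
  faces :: "'v set set"
  col   :: "'v \<Rightarrow> 'c"
  val   :: "'v set \<Rightarrow> 'p set"
  nbhd  :: "'c \<Rightarrow> 'v \<Rightarrow> 'v set set set"

definition chromatic_complex :: "'c set \<Rightarrow> 'v set \<Rightarrow> 'v set set \<Rightarrow> ('v \<Rightarrow> 'c) \<Rightarrow> bool" where
  "chromatic_complex C V F \<chi> \<longleftrightarrow>
     V \<noteq> {} \<and> F \<noteq> {} \<and>
     (\<forall>X\<in>F. finite X \<and> X \<noteq> {} \<and> X \<subseteq> V) \<and>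
     (\<forall>X\<in>F. \<forall>Y. Y \<noteq> {} \<and> Y \<subseteq> X \<longrightarrow> Y \<in> F) \<and>
     \<chi> \<in> V \<rightarrow> C \<and>
     (\<forall>X\<in>F. inj_on \<chi> X)"

definition facets :: "('v, 'c, 'p) secrecy_structure \<Rightarrow> 'v set set" where
  "facets M = {X \<in> faces M. \<forall>Y\<in>faces M. X \<subseteq> Y \<longrightarrow> Y = X}"

definition star :: "('v, 'c, 'p) secrecy_structure \<Rightarrow> 'v \<Rightarrow> 'v set set" where
  "star M v = {X \<in> facets M. v \<in> X}"

definition verts_of :: "('v, 'c, 'p) secrecy_structure \<Rightarrow> 'c \<Rightarrow> 'v set" where
  "verts_of M a = {v \<in> verts M. col M v = a}"

definition vertex_at :: "('v, 'c, 'p) secrecy_structure \<Rightarrow> 'c \<Rightarrow> 'v set \<Rightarrow> 'v" where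
  "vertex_at M a X = (THE v. v \<in> X \<and> col M v = a)"

definition indist :: "('v, 'c, 'p) secrecy_structure \<Rightarrow> 'c \<Rightarrow> 'v set \<Rightarrow> 'v set \<Rightarrow> bool" where
  "indist M a X Y \<longleftrightarrow> vertex_at M a X = vertex_at M a Y"

(* C is the colour set of the complex, A the set of agents: C = A gives the simplicial
   secrecy models over A, and C = insert c A with c outside A those with auxiliary colour c. *)
definition secrecy_model_over ::
    "'c set \<Rightarrow> 'c set \<Rightarrow> ('v, 'c, 'p) secrecy_structure \<Rightarrow> bool" where
  "secrecy_model_over C A M \<longleftrightarrow>
     chromatic_complex C (verts M) (faces M) (col M) \<and>
     (\<forall>X\<in>facets M. col M ` X = C) \<and>
     (\<forall>v\<in>verts M. \<exists>X\<in>facets M. v \<in> X) \<and>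
     (\<forall>a\<in>A. \<forall>v\<in>verts_of M a. nbhd M a v \<subseteq> Pow (facets M)) \<and>
     (\<forall>a\<in>A. \<forall>v\<in>verts_of M a. \<forall>U\<in>nbhd M a v. \<forall>X\<in>star M v. \<forall>b\<in>A - {a}.
        \<exists>Y\<in>facets M. indist M b X Y \<and> Y \<notin> U)"

abbreviation aux_secrecy_model ::
    "'c set \<Rightarrow> 'c \<Rightarrow> ('v, 'c, 'p) secrecy_structure \<Rightarrow> bool" where
  "aux_secrecy_model A c M \<equiv> secrecy_model_over (insert c A) A M"

primrec sat :: "('v, 'c, 'p) secrecy_structure \<Rightarrow> 'v set \<Rightarrow> ('p, 'c) form \<Rightarrow> bool" where
  "sat M X (Var p) \<longleftrightarrow> p \<in> val M X"
| "sat M X (Neg \<phi>) \<longleftrightarrow> \<not> sat M X \<phi>"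
| "sat M X (Conj \<phi> \<psi>) \<longleftrightarrow> sat M X \<phi> \<and> sat M X \<psi>"
| "sat M X (Know a \<phi>) \<longleftrightarrow> (\<forall>Y\<in>facets M. indist M a X Y \<longrightarrow> sat M Y \<phi>)"
| "sat M X (Secret a \<phi>) \<longleftrightarrow>
     (\<forall>Y\<in>facets M. indist M a X Y \<longrightarrow> sat M Y \<phi>) \<and>
     {Y \<in> facets M. sat M Y \<phi>} \<in> nbhd M a (vertex_at M a X)"

abbreviation share_group :: "('v, 'c, 'p) secrecy_structure \<Rightarrow> ('v set \<Rightarrow>\<^sub>0 int) set" where
  "share_group M \<equiv> carrier (free_Abelian_group (facets M))"

(* The sum is taken with the addition of finitely supported integer functions, which is the
   group operation of the free abelian group; frag_of X is the basis element of X. *)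
definition sharing ::
    "'c set \<Rightarrow> ('v, 'c, 'p) secrecy_structure \<Rightarrow> 'v set \<Rightarrow> ('c \<Rightarrow> 'v set \<Rightarrow>\<^sub>0 int) \<Rightarrow> bool" where
  "sharing A M X \<sigma> \<longleftrightarrow> \<sigma> \<in> A \<rightarrow> share_group M \<and> (\<Sum>a\<in>A. \<sigma> a) = frag_of X"

definition share_facet ::
    "'c set \<Rightarrow> ('v, 'c, 'p) secrecy_structure \<Rightarrow> 'v set \<Rightarrow> ('c \<Rightarrow> 'v set \<Rightarrow>\<^sub>0 int) \<Rightarrow>
     ('c \<times> 'v \<times> ('v set \<Rightarrow>\<^sub>0 int)) set" where
  "share_facet A M X \<sigma> = {(a, vertex_at M a X, \<sigma> a) | a. a \<in> A}"

definition lift_facets ::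
    "'c set \<Rightarrow> ('v, 'c, 'p) secrecy_structure \<Rightarrow> 'v set set \<Rightarrow>
     ('c \<times> 'v \<times> ('v set \<Rightarrow>\<^sub>0 int)) set set" where
  "lift_facets A M U = {share_facet A M Y \<tau> | Y \<tau>. Y \<in> U \<and> sharing A M Y \<tau>}"

(* The facet X is recovered from its share facet as the facet whose basis element is the sum
   of the shares, which makes the THE below well defined. *)
definition share_model ::
    "'c set \<Rightarrow> ('v, 'c, 'p) secrecy_structure \<Rightarrow>
     ('c \<times> 'v \<times> ('v set \<Rightarrow>\<^sub>0 int), 'c, 'p) secrecy_structure" where
  "share_model A M =
     \<lparr> verts = \<Union> (lift_facets A M (facets M)),
       faces = {Z. Z \<noteq> {} \<and> (\<exists>W\<in>lift_facets A M (facets M). Z \<subseteq> W)},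
       col = fst,
       val = (\<lambda>Z. val M (THE X. X \<in> facets M \<and> (\<exists>\<sigma>. sharing A M X \<sigma> \<and> Z = share_facet A M X \<sigma>))),
       nbhd = (\<lambda>a (_, v, _). lift_facets A M ` nbhd M a v) \<rparr>"

end

theory Submission
  imports Defs
begin

text \<open>
  The shares of \<open>X\<^sup>\<sigma>\<close> add up to the basis element of \<open>X\<close>, so \<open>X\<^sup>\<sigma>\<close> determines \<open>X\<close>. An agent \<open>a\<close> sees
  only its own vertex and its own share; as there is a second agent \<open>b\<close>, whose share can absorb the
  difference \<open>e\<^sub>Y - e\<^sub>X\<close>, every facet \<open>Y\<close> with \<open>X \<sim>\<^sub>a Y\<close> lifts to some \<open>Y\<^sup>\<tau>\<close> with \<open>\<tau> a = \<sigma> a\<close>. Hence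
  \<open>X\<^sup>\<sigma> \<mapsto> X\<close> is a bounded morphism for knowledge. Since every facet has a lift, \<open>U \<mapsto> U\<^sup>\<up>\<close> is injective,
  which transfers the neighbourhood condition for secrecy.
\<close>

lemma mem_share_facet_iff [simp]:
  "(a, v, g) \<in> share_facet A M X \<sigma> \<longleftrightarrow> a \<in> A \<and> v = vertex_at M a X \<and> g = \<sigma> a"
  by (auto simp: share_facet_def)

text \<open>A share facet is the graph of a function on \<open>A\<close>: it has exactly one vertex
  for each agent, so an inclusion leaves no room for further vertices.\<close>

lemma share_facet_subset_imp_eq:
  assumes "share_facet A M X \<sigma> \<subseteq> share_facet A M Y \<tau>"
  shows "share_facet A M X \<sigma> = share_facet A M Y \<tau>"
  using assms by (fastforce simp: share_facet_def)

lemma share_facet_inject: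
  assumes "sharing A M X \<sigma>" "sharing A M Y \<tau>"
    and eq: "share_facet A M X \<sigma> = share_facet A M Y \<tau>"
  shows "X = Y"
proof -
  have "\<sigma> a = \<tau> a" if "a \<in> A" for a
    using that eq mem_share_facet_iff by metis
  then have "(\<Sum>a\<in>A. \<sigma> a) = (\<Sum>a\<in>A. \<tau> a)"
    by (rule sum.cong[OF refl])
  then show ?thesis
    using assms(1,2) by (simp add: sharing_def frag_of_eq)
qed

text \<open>Membership in a lift asks for some representation of the facet; since the underlying
  facet is unique, any given representation decides it.\<close>

lemma share_facet_in_lift_facets_iff:
  assumes "sharing A M X \<sigma>"
  shows "share_facet A M X \<sigma> \<in> lift_facets A M U \<longleftrightarrow> X \<in> U"
  using assms share_facet_inject unfolding lift_facets_def by blast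

text \<open>Faces are the non-empty subsets of lifts, and the lifts form an antichain of non-empty
  sets, so they are the maximal faces.\<close>

lemma facets_share_model:
  assumes "A \<noteq> {}"
  shows "facets (share_model A M) = lift_facets A M (facets M)"
proof -
  have nonempty: "W \<noteq> {}" if "W \<in> lift_facets A M (facets M)" for W
    using that assms by (auto simp: lift_facets_def share_facet_def)
  have antichain: "W = W'" if "W \<in> lift_facets A M (facets M)"
    "W' \<in> lift_facets A M (facets M)" "W \<subseteq> W'" for W W'
    using that by (auto simp only: lift_facets_def mem_Collect_eq dest: share_facet_subset_imp_eq)
  have faces: "Z \<in> faces (share_model A M) \<longleftrightarrow>
      Z \<noteq> {} \<and> (\<exists>W\<in>lift_facets A M (facets M). Z \<subseteq> W)" for Z
    by (simp add: share_model_def)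
  have facets: "Z \<in> facets (share_model A M) \<longleftrightarrow>
      Z \<in> faces (share_model A M) \<and> (\<forall>Y\<in>faces (share_model A M). Z \<subseteq> Y \<longrightarrow> Y = Z)" for Z
    by (simp add: facets_def)
  have maximal: "W \<in> facets (share_model A M)" if W: "W \<in> lift_facets A M (facets M)" for W
  proof -
    have "Z = W" if "Z \<in> faces (share_model A M)" "W \<subseteq> Z" for Z
    proof -
      obtain W' where W': "W' \<in> lift_facets A M (facets M)" "Z \<subseteq> W'"
        using \<open>Z \<in> faces (share_model A M)\<close> faces by blast
      with W \<open>W \<subseteq> Z\<close> have "W = W'"
        by (intro antichain) auto
      with W' \<open>W \<subseteq> Z\<close> show ?thesis
        by blast
    qed
    moreover have "W \<in> faces (share_model A M)"
      using W nonempty faces by blast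
    ultimately show ?thesis
      using facets by blast
  qed
  have "W \<in> lift_facets A M (facets M)" if W: "W \<in> facets (share_model A M)" for W
  proof -
    obtain W' where W': "W' \<in> lift_facets A M (facets M)" "W \<subseteq> W'"
      using W facets faces by metis
    then have "W' \<in> faces (share_model A M)"
      using maximal facets by metis
    with W W' have "W' = W"
      using facets by metis
    with W' show ?thesis
      by simp
  qed
  with maximal show ?thesis by blast
qed

lemma vertex_at_share_model:
  assumes "a \<in> A"
  shows "vertex_at (share_model A M) a (share_facet A M X \<sigma>) = (a, vertex_at M a X, \<sigma> a)"
  unfolding vertex_at_def [of "share_model A M"]
  using assms by (intro the_equality) (auto simp: share_model_def)

lemma indist_share_model_iff:
  assumes "a \<in> A"
  shows "indist (share_model A M) a (share_facet A M X \<sigma>) (share_facet A M Y \<tau>)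
    \<longleftrightarrow> indist M a X Y \<and> \<sigma> a = \<tau> a"
  using assms by (simp add: indist_def vertex_at_share_model)

lemma val_share_model:
  assumes "X \<in> facets M" "sharing A M X \<sigma>"
  shows "val (share_model A M) (share_facet A M X \<sigma>) = val M X"
proof -
  have "(THE Y. Y \<in> facets M \<and> (\<exists>\<tau>. sharing A M Y \<tau> \<and>
      share_facet A M X \<sigma> = share_facet A M Y \<tau>)) = X"
    using assms share_facet_inject by (intro the_equality) blast+
  then show ?thesis
    by (simp add: share_model_def)
qed

lemma share_group_iff: "g \<in> share_group M \<longleftrightarrow> Poly_Mapping.keys g \<subseteq> facets M"
  by (simp add: free_Abelian_group_def)

lemma sharing_exists:
  assumes "finite A" "A \<noteq> {}" "X \<in> facets M"
  obtains \<sigma> where "sharing A M X \<sigma>"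
proof -
  obtain b where "b \<in> A"
    using assms by blast
  \<comment> \<open>One agent holds the whole basis element and all others hold 0.\<close>
  then have "sharing A M X (\<lambda>a. if a = b then frag_of X else 0)"
    using assms by (auto simp: sharing_def share_group_iff)
  then show thesis
    by (rule that)
qed

lemma sharing_update:
  assumes "finite A" "b \<in> A" "X \<in> facets M" "Y \<in> facets M" "sharing A M X \<sigma>"
  shows "sharing A M Y (\<sigma>(b := \<sigma> b + (frag_of Y - frag_of X)))" (is "sharing A M Y ?\<tau>")
proof -
  have "Poly_Mapping.keys (\<sigma> b + (frag_of Y - frag_of X)) \<subseteq> facets M"
    using assms keys_add[of "\<sigma> b" "frag_of Y - frag_of X"] keys_diff[of "frag_of Y" "frag_of X"]
    by (force simp: sharing_def share_group_iff Pi_iff)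
  moreover have "(\<Sum>a\<in>A. ?\<tau> a) = (\<Sum>a\<in>A. \<sigma> a) + (frag_of Y - frag_of X)"
    using assms by (simp add: sum.remove[of A b])
  ultimately show ?thesis
    using assms by (auto simp: sharing_def share_group_iff Pi_iff)
qed

lemma sharing_transfer:
  assumes "finite A" "card A \<ge> 2" "X \<in> facets M" "Y \<in> facets M" "sharing A M X \<sigma>"
  obtains \<tau> where "sharing A M Y \<tau>" "\<tau> a = \<sigma> a"
proof -
  \<comment> \<open>Two agents do not fit into \<open>{a}\<close>, so someone other than
    \<open>a\<close> can take the correction and the share of \<open>a\<close> stays fixed.\<close>
  have "\<not> A \<subseteq> {a}"
    using assms card_mono[of "{a}" A] by fastforce
  then obtain b where "b \<in> A" "b \<noteq> a"
    by blast
  then show thesis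
    using that sharing_update[OF assms(1) _ assms(3-5)] by (metis fun_upd_other)
qed

lemma lift_facets_inj_on:
  assumes "finite A" "A \<noteq> {}"
  shows "inj_on (lift_facets A M) (Pow (facets M))"
proof -
  have "U \<subseteq> W"
    if "U \<subseteq> facets M" "lift_facets A M U = lift_facets A M W" for U W
  proof
    fix Y assume "Y \<in> U"
    with that obtain \<tau> where "sharing A M Y \<tau>"
      using assms sharing_exists by (metis subsetD)
    with \<open>Y \<in> U\<close> that show "Y \<in> W"
      using share_facet_in_lift_facets_iff by metis
  qed
  then show ?thesis
    by (intro inj_onI) (simp add: subset_antisym)
qed

text \<open>The model constrains neighbourhoods only at vertices of the right colour. The vertex
  exists because a facet carries all colours of \<open>C\<close>, and is unique because colouring is
  injective on faces.\<close>

lemma vertex_at_in_verts_of: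
  assumes "secrecy_model_over C A M" "X \<in> facets M" "a \<in> C"
  shows "vertex_at M a X \<in> verts_of M a"
proof -
  have X: "X \<subseteq> verts M" "inj_on (col M) X" "a \<in> col M ` X"
    using assms by (auto simp: secrecy_model_over_def chromatic_complex_def facets_def)
  then have "\<exists>!v. v \<in> X \<and> col M v = a"
    by (auto dest: inj_onD)
  then have "vertex_at M a X \<in> X \<and> col M (vertex_at M a X) = a"
    unfolding vertex_at_def by (rule theI')
  with X show ?thesis
    by (auto simp: verts_of_def)
qed

text \<open>The induction hypothesis is made an assumption so that the knowledge conjunct of
  \<open>Secret\<close> can reuse the argument for \<open>Know\<close>.\<close>

lemma sat_Know_share_model_iff:
  assumes "finite A" "card A \<ge> 2" "a \<in> A" "X \<in> facets M" "sharing A M X \<sigma>"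
    and IH: "\<And>Y \<tau>. Y \<in> facets M \<Longrightarrow> sharing A M Y \<tau> \<Longrightarrow>
      sat (share_model A M) (share_facet A M Y \<tau>) \<phi> \<longleftrightarrow> sat M Y \<phi>"
  shows "sat (share_model A M) (share_facet A M X \<sigma>) (Know a \<phi>) \<longleftrightarrow> sat M X (Know a \<phi>)"
proof
  have facet: "share_facet A M Y \<tau> \<in> facets (share_model A M)"
    if "Y \<in> facets M" "sharing A M Y \<tau>" for Y \<tau>
    using that \<open>a \<in> A\<close> by (subst facets_share_model) (auto simp: share_facet_in_lift_facets_iff)
  assume sat: "sat (share_model A M) (share_facet A M X \<sigma>) (Know a \<phi>)"
  have "sat M Y \<phi>" if Y: "Y \<in> facets M" "indist M a X Y" for Y
  proof -
    \<comment> \<open>The lift of \<open>Y\<close> must keep the share of \<open>a\<close>, or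
      \<open>a\<close> could tell it from the lift of \<open>X\<close>.\<close>
    obtain \<tau> where \<tau>: "sharing A M Y \<tau>" "\<tau> a = \<sigma> a"
      using sharing_transfer[OF assms(1,2,4) Y(1) assms(5)] .
    then have "sat (share_model A M) (share_facet A M Y \<tau>) \<phi>"
      using sat facet Y \<open>a \<in> A\<close> by (simp add: indist_share_model_iff)
    with IH Y \<tau> show ?thesis
      by blast
  qed
  then show "sat M X (Know a \<phi>)"
    by simp
next
  have "A \<noteq> {}"
    using \<open>a \<in> A\<close> by blast
  moreover assume "sat M X (Know a \<phi>)"
  ultimately show "sat (share_model A M) (share_facet A M X \<sigma>) (Know a \<phi>)"
    using IH \<open>a \<in> A\<close>
    by (auto simp: facets_share_model lift_facets_def indist_share_model_iff)
qed

text \<open>Both modalities move to other facets with other shares, so the induction generalises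
  over \<open>X\<close> and \<open>\<sigma>\<close>.\<close>

lemma sat_share_model_iff:
  assumes "finite A" "card A \<ge> 2" "A \<subseteq> C" "secrecy_model_over C A M"
    and "\<phi> \<in> L_KS A" "X \<in> facets M" "sharing A M X \<sigma>"
  shows "sat (share_model A M) (share_facet A M X \<sigma>) \<phi> \<longleftrightarrow> sat M X \<phi>"
  using assms(5-7)
proof (induction arbitrary: X \<sigma> rule: L_KS.induct)
  case (1 p)
  then show ?case
    by (simp add: val_share_model)
next
  case (4 a \<phi>)
  then show ?case
    using assms by (intro sat_Know_share_model_iff)
next
  case (5 a \<phi>)
  have "A \<noteq> {}"
    using assms(2) by auto
  have know: "sat (share_model A M) (share_facet A M X \<sigma>) (Know a \<phi>) \<longleftrightarrow> sat M X (Know a \<phi>)"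
    using assms 5 by (intro sat_Know_share_model_iff)
  \<comment> \<open>By induction, truth at a share facet depends only on the facet below it, so the
    truth set upstairs is a lift.\<close>
  have truth: "{Z \<in> facets (share_model A M). sat (share_model A M) Z \<phi>}
      = lift_facets A M {Y \<in> facets M. sat M Y \<phi>}"
    using "5.IH" \<open>A \<noteq> {}\<close> by (auto simp: facets_share_model lift_facets_def)
  \<comment> \<open>Lifting is known to be injective on sets of facets, so the neighbourhoods must
    consist of such sets before membership can be reflected.\<close>
  have "nbhd M a (vertex_at M a X) \<subseteq> Pow (facets M)"
    using vertex_at_in_verts_of[OF assms(4) "5.prems"(1), of a] assms(3,4) \<open>a \<in> A\<close>
    unfolding secrecy_model_over_def by blast
  then have "lift_facets A M {Y \<in> facets M. sat M Y \<phi>} \<in>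
        lift_facets A M ` nbhd M a (vertex_at M a X)
      \<longleftrightarrow> {Y \<in> facets M. sat M Y \<phi>} \<in> nbhd M a (vertex_at M a X)"
    using lift_facets_inj_on[OF assms(1) \<open>A \<noteq> {}\<close>] by (intro inj_on_image_mem_iff) auto
  moreover have "nbhd (share_model A M) a (a, vertex_at M a X, \<sigma> a)
      = lift_facets A M ` nbhd M a (vertex_at M a X)"
    by (simp add: share_model_def)
  ultimately show ?case
    using know \<open>a \<in> A\<close> by (simp add: truth vertex_at_share_model)
qed simp_all

theorem theorem5p22:
  fixes A :: "'c set" and aux :: 'c
    and M :: "('v, 'c, 'p::countable) secrecy_structure"
    and \<phi> :: "('p, 'c) form" and X :: "'v set"
    and \<sigma> :: "'c \<Rightarrow> 'v set \<Rightarrow>\<^sub>0 int"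
  assumes "finite A" and "card A \<ge> 2"
    and "aux \<notin> A" and "aux_secrecy_model A aux M"
    and "\<phi> \<in> L_KS A"
    and "X \<in> facets M"
    and "\<sigma> \<in> A \<rightarrow> share_group M" and "(\<Sum>a\<in>A. \<sigma> a) = frag_of X"
  shows "sat (share_model A M) (share_facet A M X \<sigma>) \<phi> \<longleftrightarrow> sat M X \<phi>"
  using assms by (intro sat_share_model_iff[of A "insert aux A"]) (auto simp: sharing_def)

end
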